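(* Let $\Gamma$ be a symmetric positive-definite $d\times d$ matrix, and let $\phi_0$ and $\chi_0$ be the quantities defined in the context. There exists a positive constant $C$ independent of the dimension $d$, the kernel $K$ and the terminal time $T$ such that $$0\le\chi_0-\phi_0\le C\,\big(\mathrm{Cond}(\Gamma)-1\big)\int_0^T\|K(T,t)\|^2\,dt,$$ where $\mathrm{Cond}(\Gamma)=\lambda_{\max}/\lambda_{\min}$ is the condition number of $\Gamma$, i.e. the ratio of its largest eigenvalue $\lambda_{\max}$ to its smallest eigenvalue $\lambda_{\min}$.
   Context: $T>0$ is the terminal time and $\gamma_A,\gamma_P>0$ are the risk-aversion parameters of the agent and the principal. $K:[0,T]^2\to\mathbb{R}^d$ is a measurable Volterra kernel, i.e. $K(t,s)=0$ for $s\ge t$, with $\sup_{t\le T}\int_0^T\|K(t,s)\|^2ds<\infty$. Write $K_T(s)=K(T,s)$ and $\langle f,g\rangle_{L^2}=\int_0^T\langle f(s),g(s)\rangle ds$, with $\langle\cdot,\cdot\rangle$ and $\|\cdot\|$ the canonical inner product and norm of $\mathbb{R}^d$. Define $$\phi_0=\frac{\gamma_P}{2}\Big\langle K_T,\Big(\gamma_PI_d-(\gamma_PI_d+\Gamma^{-1})\big((\gamma_A+\gamma_P)I_d+\Gamma^{-1}\big)^{-1}(\gamma_PI_d+\Gamma^{-1})\Big)K_T\Big\rangle_{L^2},$$ $$b^*=\frac{\langle K_T,(\gamma_PI_d+\Gamma^{-1})K_T\rangle_{L^2}}{\langle K_T,((\gamma_A+\gamma_P)I_d+\Gamma^{-1})K_T\rangle_{L^2}},\qquad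 \chi_0=\frac{\gamma_P}{2}\Big\langle K_T,\big(\gamma_PI_d-b^*(\gamma_PI_d+\Gamma^{-1})\big)K_T\Big\rangle_{L^2}.$$ (In the underlying principal-agent model with deterministic input curve $g_0$, agent's reservation utility $-e^{-\gamma_Ay_0}$ and effort cost $\frac12\langle a,\Gamma a\rangle$, the numbers $-\exp(-\gamma_P(g_0(T)-y_0)+\phi_0)$ and $-\exp(-\gamma_P(g_0(T)-y_0)+\chi_0)$ are the principal's optimal utilities when she has the agent's information and when she is restricted to linear contracts, respectively.) *)

theory Defs
  imports "HOL-Analysis.Analysis" "Jordan_Normal_Form.Spectral_Radius"
    "Jordan_Normal_Form.Gauss_Jordan_Elimination"
begin

text \<open>
  The constant of the theorem must be uniform in the dimension \<open>d\<close>, so \<open>d\<close> is quantified inside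
  the formula. Vectors and matrices are therefore the carrier-based ones of Jordan Normal Form,
  not those of HOL-Analysis, which have the dimension in their type. \<open>scalar_prod\<close> is the canonical
  inner product of \<open>\<real>\<^sup>d\<close>.
\<close>

unbundle no inner_syntax
hide_const (open) Finite_Cartesian_Product.vec
hide_type (open) Finite_Cartesian_Product.vec

definition euclid_norm :: "real vec \<Rightarrow> real" where
  "euclid_norm v = sqrt (scalar_prod v v)"

definition sym_pos_def :: "nat \<Rightarrow> real mat \<Rightarrow> bool" where
  "sym_pos_def d A \<longleftrightarrow> A \<in> carrier_mat d d \<and> transpose_mat A = A \<and>
     (\<forall>v \<in> carrier_vec d. v \<noteq> 0\<^sub>v d \<longrightarrow> scalar_prod v (A *\<^sub>v v) > 0)"

text \<open>Measurability is Borel measurability of each component on \<open>[0,T]\<^sup>2\<close>; values of \<open>K\<close> outside the square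
  are irrelevant.\<close>

definition volterra_kernel :: "nat \<Rightarrow> real \<Rightarrow> (real \<Rightarrow> real \<Rightarrow> real vec) \<Rightarrow> bool" where
  "volterra_kernel d T K \<longleftrightarrow>
     (\<forall>t \<in> {0..T}. \<forall>s \<in> {0..T}. K t s \<in> carrier_vec d) \<and>
     (\<forall>i < d. (\<lambda>(t, s). vec_index (K t s) i)
        \<in> borel_measurable (restrict_space borel ({0..T} \<times> {0..T}))) \<and>
     (\<forall>t \<in> {0..T}. \<forall>s \<in> {0..T}. s \<ge> t \<longrightarrow> K t s = 0\<^sub>v d) \<and>
     (SUP t \<in> {0..T}. \<integral>\<^sup>+ s \<in> {0..T}. ennreal ((euclid_norm (K t s))\<^sup>2) \<partial>lborel) < \<infinity>"

definition L2_inner :: "real \<Rightarrow> (real \<Rightarrow> real vec) \<Rightarrow> (real \<Rightarrow> real vec) \<Rightarrow> real" where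
  "L2_inner T f g = (LBINT s:{0..T}. scalar_prod (f s) (g s))"

text \<open>A matrix acts on a vector-valued function pointwise.\<close>

definition L2_form :: "real \<Rightarrow> real mat \<Rightarrow> (real \<Rightarrow> real vec) \<Rightarrow> real" where
  "L2_form T A f = L2_inner T f (\<lambda>s. A *\<^sub>v f s)"

text \<open>\<open>mat_inverse\<close> is \<open>Some\<close> of the inverse on invertible matrices; only those are inverted below.\<close>

definition matinv :: "real mat \<Rightarrow> real mat" where
  "matinv A = the (mat_inverse A)"

definition shifted_inv :: "nat \<Rightarrow> real \<Rightarrow> real mat \<Rightarrow> real mat" where
  "shifted_inv d c \<Gamma> = c \<cdot>\<^sub>m 1\<^sub>m d + matinv \<Gamma>"

definition phi0 ::
  "nat \<Rightarrow> real \<Rightarrow> real \<Rightarrow> real mat \<Rightarrow> real \<Rightarrow> (real \<Rightarrow> real \<Rightarrow> real vec) \<Rightarrow> real" where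
  "phi0 d \<gamma>\<^sub>A \<gamma>\<^sub>P \<Gamma> T K =
     \<gamma>\<^sub>P / 2 * L2_form T
       (\<gamma>\<^sub>P \<cdot>\<^sub>m 1\<^sub>m d
          - shifted_inv d \<gamma>\<^sub>P \<Gamma> * matinv (shifted_inv d (\<gamma>\<^sub>A + \<gamma>\<^sub>P) \<Gamma>) * shifted_inv d \<gamma>\<^sub>P \<Gamma>)
       (K T)"

text \<open>If \<open>K T\<close> vanishes almost everywhere this is \<open>0 / 0 = 0\<close>; then \<open>chi0\<close> is \<open>0\<close> whatever the
  value of \<open>b_star\<close>.\<close>

definition b_star ::
  "nat \<Rightarrow> real \<Rightarrow> real \<Rightarrow> real mat \<Rightarrow> real \<Rightarrow> (real \<Rightarrow> real \<Rightarrow> real vec) \<Rightarrow> real" where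
  "b_star d \<gamma>\<^sub>A \<gamma>\<^sub>P \<Gamma> T K =
     L2_form T (shifted_inv d \<gamma>\<^sub>P \<Gamma>) (K T) / L2_form T (shifted_inv d (\<gamma>\<^sub>A + \<gamma>\<^sub>P) \<Gamma>) (K T)"

definition chi0 ::
  "nat \<Rightarrow> real \<Rightarrow> real \<Rightarrow> real mat \<Rightarrow> real \<Rightarrow> (real \<Rightarrow> real \<Rightarrow> real vec) \<Rightarrow> real" where
  "chi0 d \<gamma>\<^sub>A \<gamma>\<^sub>P \<Gamma> T K =
     \<gamma>\<^sub>P / 2 * L2_form T
       (\<gamma>\<^sub>P \<cdot>\<^sub>m 1\<^sub>m d - b_star d \<gamma>\<^sub>A \<gamma>\<^sub>P \<Gamma> T K \<cdot>\<^sub>m shifted_inv d \<gamma>\<^sub>P \<Gamma>)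
       (K T)"

text \<open>The spectrum of a real symmetric matrix as a real matrix is its whole spectrum.\<close>

definition Cond :: "real mat \<Rightarrow> real" where
  "Cond \<Gamma> = Max (spectrum \<Gamma>) / Min (spectrum \<Gamma>)"

end

theory Submission
  imports Defs
begin

text \<open>
  Put \<open>a = \<gamma>\<^sub>A\<close>, \<open>R = (\<gamma>\<^sub>A + \<gamma>\<^sub>P) I + \<Gamma>\<^sup>-\<^sup>1\<close> and \<open>P = \<gamma>\<^sub>P I + \<Gamma>\<^sup>-\<^sup>1 = R - a I\<close>, so that
  \<open>P R\<^sup>-\<^sup>1 P = R - 2 a I + a\<^sup>2 R\<^sup>-\<^sup>1\<close>. With \<open>X\<close>, \<open>Y\<close>, \<open>n\<close> the values at \<open>K\<^sub>T\<close> of the quadratic forms of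
  \<open>R\<close>, \<open>R\<^sup>-\<^sup>1\<close> and \<open>I\<close>, the difference \<open>\<chi>\<^sub>0 - \<phi>\<^sub>0\<close> becomes \<open>\<gamma>\<^sub>P a\<^sup>2 (Y - n\<^sup>2 / X) / 2\<close>. It is nonnegative
  because \<open>n\<^sup>2 \<le> X Y\<close> (Cauchy-Schwarz), and it is at most
  \<open>\<gamma>\<^sub>P a\<^sup>2 n (1 / \<rho> - 1 / \<beta>) / 2\<close> when \<open>\<rho> I \<le> R \<le> \<beta> I\<close>; the extreme eigenvalues of \<open>\<Gamma>\<close> give
  \<open>\<rho> = a + \<gamma>\<^sub>P + 1 / \<lambda>\<^bsub>max\<^esub>\<close> and \<open>\<beta> = a + \<gamma>\<^sub>P + 1 / \<lambda>\<^bsub>min\<^esub>\<close>.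
\<close>

unbundle no vec_syntax

section \<open>Quadratic forms of real matrices\<close>

definition qform :: "real mat \<Rightarrow> real vec \<Rightarrow> real" where
  "qform A v = v \<bullet> (A *\<^sub>v v)"

lemma scalar_prod_self_nonneg: "0 \<le> v \<bullet> (v :: real vec)"
  by (auto simp: scalar_prod_def intro!: sum_nonneg)

lemma scalar_prod_self_pos: "v \<in> carrier_vec d \<Longrightarrow> v \<noteq> 0\<^sub>v d \<Longrightarrow> 0 < v \<bullet> (v :: real vec)"
  using conjugate_square_greater_0_vec[of v d] by (simp add: conjugate_vec_def)

text \<open>AM-GM, as each square is one term of \<open>v \<bullet> v\<close>. This domination of
  entry products gives both the boundedness of quadratic forms and the integrability of products of
  kernel entries.\<close>

lemma abs_mult_index_le_scalar_prod_self:
  fixes v :: "real vec"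
  assumes v: "v \<in> carrier_vec d" and i: "i < d" and j: "j < d"
  shows "\<bar>v $ i * v $ j\<bar> \<le> v \<bullet> v"
proof -
  have sq: "(v $ k)\<^sup>2 \<le> v \<bullet> v" if "k < d" for k
    using that v member_le_sum[of k "{0..<d}" "\<lambda>i. v $ i * v $ i"]
    by (simp add: scalar_prod_def power2_eq_square)
  have "2 * \<bar>v $ i * v $ j\<bar> \<le> (v $ i)\<^sup>2 + (v $ j)\<^sup>2"
    using sum_squares_bound[of "\<bar>v $ i\<bar>" "\<bar>v $ j\<bar>"] by (simp add: abs_mult)
  then show ?thesis using sq[OF i] sq[OF j] by linarith
qed

lemma qform_eq_sum:
  assumes "A \<in> carrier_mat d d" "v \<in> carrier_vec d"
  shows "qform A v = (\<Sum>i<d. \<Sum>j<d. A $$ (i, j) * (v $ i * v $ j))"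
  using assms unfolding qform_def scalar_prod_def
  by (auto simp: scalar_prod_def sum_distrib_left atLeast0LessThan intro!: sum.cong)

lemma qform_bounded:
  assumes A: "A \<in> carrier_mat d d"
  obtains k where "k > 0" "\<And>v. v \<in> carrier_vec d \<Longrightarrow> \<bar>qform A v\<bar> \<le> k * (v \<bullet> v)"
proof
  let ?k = "\<Sum>i<d. \<Sum>j<d. \<bar>A $$ (i, j)\<bar>"
  \<comment> \<open>The summand \<open>1\<close> keeps the bound positive for the zero matrix too,
    so that it may be divided by.\<close>
  show "1 + ?k > 0" by (intro add_pos_nonneg sum_nonneg) auto
  fix v :: "real vec" assume v: "v \<in> carrier_vec d"
  have "\<bar>qform A v\<bar> \<le> (\<Sum>i<d. \<Sum>j<d. \<bar>A $$ (i, j) * (v $ i * v $ j)\<bar>)"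
    unfolding qform_eq_sum[OF A v]
    by (rule order_trans[OF sum_abs]) (intro sum_mono sum_abs)
  also have "\<dots> \<le> (\<Sum>i<d. \<Sum>j<d. \<bar>A $$ (i, j)\<bar> * (v \<bullet> v))"
    unfolding abs_mult[of "A $$ _"]
    by (intro sum_mono mult_left_mono abs_mult_index_le_scalar_prod_self[OF v]) auto
  also have "\<dots> = ?k * (v \<bullet> v)" by (simp add: sum_distrib_right)
  also have "\<dots> \<le> (1 + ?k) * (v \<bullet> v)" using scalar_prod_self_nonneg[of v] by (simp add: algebra_simps)
  finally show "\<bar>qform A v\<bar> \<le> (1 + ?k) * (v \<bullet> v)" .
qed

lemma transpose_smult: "transpose_mat (c \<cdot>\<^sub>m A) = c \<cdot>\<^sub>m transpose_mat A"
  by (rule eq_matI) auto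

lemma qform_add:
  assumes "A \<in> carrier_mat d d" "B \<in> carrier_mat d d" "v \<in> carrier_vec d"
  shows "qform (A + B) v = qform A v + qform B v"
  using assms unfolding qform_def
  by (simp add: add_mult_distrib_mat_vec[of _ d d] scalar_prod_add_distrib[of _ d])

lemma qform_minus:
  assumes "A \<in> carrier_mat d d" "B \<in> carrier_mat d d" "v \<in> carrier_vec d"
  shows "qform (A - B) v = qform A v - qform B v"
  using assms unfolding qform_def
  by (simp add: minus_mult_distrib_mat_vec[of _ d d] scalar_prod_minus_distrib[of _ d])

lemma qform_smult:
  assumes "A \<in> carrier_mat d d" "v \<in> carrier_vec d"
  shows "qform (c \<cdot>\<^sub>m A) v = c * qform A v"
  using assms by (simp add: qform_eq_sum[of _ d] sum_distrib_left mult.assoc)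

lemma qform_one: "v \<in> carrier_vec d \<Longrightarrow> qform (1\<^sub>m d) v = v \<bullet> v"
  by (simp add: qform_def)

lemma symmetric_mat_scalar_prod:
  fixes A :: "real mat"
  assumes A: "A \<in> carrier_mat d d" and sym: "transpose_mat A = A"
    and u: "u \<in> carrier_vec d" and v: "v \<in> carrier_vec d"
  shows "u \<bullet> (A *\<^sub>v v) = (A *\<^sub>v u) \<bullet> v"
  using transpose_vec_mult_scalar[OF A v u] sym by simp

text \<open>Symmetry merges the two cross terms. The inequalities below between a matrix and its
  inverse come from this expansion at a suitable \<open>t\<close>.\<close>

lemma qform_minus_smult_vec:
  assumes A: "A \<in> carrier_mat d d" and sym: "transpose_mat A = A"
    and u: "u \<in> carrier_vec d" and v: "v \<in> carrier_vec d"
  shows "qform A (v - t \<cdot>\<^sub>v u) = qform A v - 2 * t * (u \<bullet> (A *\<^sub>v v)) + t\<^sup>2 * qform A u"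
proof -
  have "v \<bullet> (A *\<^sub>v u) = u \<bullet> (A *\<^sub>v v)"
    using symmetric_mat_scalar_prod[OF A sym u v] comm_scalar_prod[of v d "A *\<^sub>v u"] A u v by auto
  then show ?thesis
    using A u v unfolding qform_def
    by (simp add: mult_minus_distrib_mat_vec[of _ d d] scalar_prod_minus_distrib[of _ d]
        minus_scalar_prod_distrib[of _ d] mult_mat_vec[of _ d d] power2_eq_square algebra_simps)
qed

text \<open>This is \<open>A^2 \<le> \<beta> A\<close> for \<open>0 \<le> A \<le> \<beta> I\<close>,
  obtained without diagonalisation: the form is nonnegative at \<open>v - A v / \<beta>\<close>, and
  its quadratic term there is bounded through \<open>\<beta>\<close>.\<close>

lemma scalar_prod_mult_mat_vec_le:
  assumes A: "A \<in> carrier_mat d d" and sym: "transpose_mat A = A" and v: "v \<in> carrier_vec d"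
    and psd: "\<And>v. v \<in> carrier_vec d \<Longrightarrow> 0 \<le> qform A v"
    and bound: "\<And>v. v \<in> carrier_vec d \<Longrightarrow> qform A v \<le> \<beta> * (v \<bullet> v)" and "\<beta> > 0"
  shows "(A *\<^sub>v v) \<bullet> (A *\<^sub>v v) \<le> \<beta> * qform A v"
proof -
  let ?w = "A *\<^sub>v v"
  have w: "?w \<in> carrier_vec d" using A v by simp
  have "0 \<le> qform A (v - (1 / \<beta>) \<cdot>\<^sub>v ?w)" using psd v w by simp
  also have "\<dots> = qform A v - 2 / \<beta> * (?w \<bullet> ?w) + qform A ?w / \<beta>\<^sup>2"
    using qform_minus_smult_vec[OF A sym w v, of "1 / \<beta>"] by (simp add: power_divide)
  also have "\<dots> \<le> qform A v - 2 / \<beta> * (?w \<bullet> ?w) + \<beta> * (?w \<bullet> ?w) / \<beta>\<^sup>2"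
    using bound[OF w] by (simp add: divide_right_mono)
  also have "\<dots> = qform A v - (?w \<bullet> ?w) / \<beta>"
    using \<open>\<beta> > 0\<close> by (simp add: power2_eq_square field_simps)
  finally show ?thesis using \<open>\<beta> > 0\<close> by (simp add: field_simps)
qed

section \<open>Inverses and their quadratic forms\<close>

text \<open>A trivial kernel makes the determinant nonzero, so \<open>mat_inverse\<close> returns
  \<open>Some\<close> and the \<open>the\<close> in \<open>matinv\<close> yields a genuine
  inverse.\<close>

lemma injective_mat_inverse:
  fixes A :: "real mat"
  assumes A: "A \<in> carrier_mat d d"
    and inj: "\<And>v. v \<in> carrier_vec d \<Longrightarrow> A *\<^sub>v v = 0\<^sub>v d \<Longrightarrow> v = 0\<^sub>v d"
  shows "matinv A \<in> carrier_mat d d" "A * matinv A = 1\<^sub>m d" "matinv A * A = 1\<^sub>m d"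
proof -
  have "det A \<noteq> 0" using det_0_iff_vec_prod_zero[OF A] inj by auto
  then have "A \<in> Units (ring_mat TYPE(real) d undefined)" by (rule det_non_zero_imp_unit[OF A])
  then obtain B where "mat_inverse A = Some B" using mat_inverse(1)[OF A, of undefined] by (cases "mat_inverse A") auto
  with mat_inverse(2)[OF A this]
  show "matinv A \<in> carrier_mat d d" "A * matinv A = 1\<^sub>m d" "matinv A * A = 1\<^sub>m d"
    by (auto simp: matinv_def)
qed

text \<open>Transposing \<open>A * B = 1\<close> makes the transpose of \<open>B\<close> a left
  inverse of \<open>A\<close>; it equals the right inverse \<open>B\<close>.\<close>

lemma transpose_inverse_symmetric:
  fixes A :: "real mat"
  assumes A: "A \<in> carrier_mat d d" and sym: "transpose_mat A = A" and B: "B \<in> carrier_mat d d"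
    and AB: "A * B = 1\<^sub>m d" and BA: "B * A = 1\<^sub>m d"
  shows "transpose_mat B = B"
proof -
  have "transpose_mat B * A = 1\<^sub>m d" using transpose_mult[OF A B] AB sym by simp
  then have "transpose_mat B * A * B = B" using B by simp
  moreover have "transpose_mat B * A * B = transpose_mat B * (A * B)"
    using A B by (intro assoc_mult_mat[of _ d d _ d _ d]) auto
  ultimately show ?thesis using AB B by simp
qed

lemma qform_inverse:
  assumes A: "A \<in> carrier_mat d d" and B: "B \<in> carrier_mat d d"
    and AB: "A * B = 1\<^sub>m d" and v: "v \<in> carrier_vec d"
  shows "A *\<^sub>v (B *\<^sub>v v) = v" "qform B v = qform A (B *\<^sub>v v)"
proof -
  have Bv: "B *\<^sub>v v \<in> carrier_vec d" using B v by simp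
  show *: "A *\<^sub>v (B *\<^sub>v v) = v"
    using assoc_mult_mat_vec[OF A B v] AB v by simp
  show "qform B v = qform A (B *\<^sub>v v)" unfolding qform_def * using comm_scalar_prod[OF Bv v] by simp
qed

text \<open>With \<open>w = B v\<close>, the square of \<open>v - \<alpha> w\<close> is nonnegative
  and has cross term \<open>- 2 \<alpha> (qform B v)\<close>. The lower bound on \<open>A\<close> at
  \<open>w\<close> absorbs half of it, because \<open>qform A w = qform B v\<close>.\<close>

lemma qform_inverse_le:
  assumes A: "A \<in> carrier_mat d d" and B: "B \<in> carrier_mat d d"
    and AB: "A * B = 1\<^sub>m d" and v: "v \<in> carrier_vec d"
    and bound: "\<And>v. v \<in> carrier_vec d \<Longrightarrow> \<alpha> * (v \<bullet> v) \<le> qform A v" and "\<alpha> > 0"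
  shows "qform B v \<le> (v \<bullet> v) / \<alpha>"
proof -
  let ?w = "B *\<^sub>v v"
  have w: "?w \<in> carrier_vec d" using B v by simp
  note inv = qform_inverse[OF A B AB v]
  have "0 \<le> (v - \<alpha> \<cdot>\<^sub>v ?w) \<bullet> (v - \<alpha> \<cdot>\<^sub>v ?w)" by (rule scalar_prod_self_nonneg)
  also have "\<dots> = v \<bullet> v - 2 * \<alpha> * (?w \<bullet> v) + \<alpha>\<^sup>2 * (?w \<bullet> ?w)"
    using qform_minus_smult_vec[of "1\<^sub>m d" d ?w v \<alpha>] v w by (simp add: qform_def)
  also have "?w \<bullet> v = qform B v" using comm_scalar_prod[OF w v] by (simp add: qform_def)
  also have "\<alpha>\<^sup>2 * (?w \<bullet> ?w) \<le> \<alpha> * qform B v"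
    using bound[OF w] \<open>\<alpha> > 0\<close> inv(2) by (simp add: power2_eq_square mult.assoc)
  finally have "\<alpha> * qform B v \<le> v \<bullet> v" by simp
  then show ?thesis using \<open>\<alpha> > 0\<close> by (simp add: field_simps)
qed

text \<open>The inequality \<open>A^2 \<le> \<beta> A\<close> evaluated at \<open>B v\<close>, which
  \<open>A\<close> sends to \<open>v\<close>.\<close>

lemma qform_inverse_ge:
  assumes A: "A \<in> carrier_mat d d" and sym: "transpose_mat A = A" and B: "B \<in> carrier_mat d d"
    and AB: "A * B = 1\<^sub>m d" and v: "v \<in> carrier_vec d"
    and psd: "\<And>v. v \<in> carrier_vec d \<Longrightarrow> 0 \<le> qform A v"
    and bound: "\<And>v. v \<in> carrier_vec d \<Longrightarrow> qform A v \<le> \<beta> * (v \<bullet> v)" and "\<beta> > 0"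
  shows "(v \<bullet> v) / \<beta> \<le> qform B v"
proof -
  have "B *\<^sub>v v \<in> carrier_vec d" using B v by simp
  from scalar_prod_mult_mat_vec_le[OF A sym this psd bound \<open>\<beta> > 0\<close>]
  show ?thesis using qform_inverse[OF A B AB v] \<open>\<beta> > 0\<close> by (simp add: field_simps)
qed

section \<open>Extreme eigenvalues of symmetric matrices\<close>

text \<open>The least eigenvalue is the supremum of the \<open>c\<close> for which \<open>A - c I\<close> is positive semidefinite: if
  \<open>A - c I\<close> were invertible at the supremum, it would be bounded below by a positive multiple of
  the identity.\<close>

lemma symmetric_mat_least_eigenvalue:
  assumes A: "A \<in> carrier_mat d d" and sym: "transpose_mat A = A" and "d > 0"
  obtains c where "eigenvalue A c" "\<And>v. v \<in> carrier_vec d \<Longrightarrow> c * (v \<bullet> v) \<le> qform A v"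
proof -
  define S where "S = {c. \<forall>v \<in> carrier_vec d. c * (v \<bullet> v) \<le> qform A v}"
  define c where "c = Sup S"
  obtain k where k: "k > 0" "\<And>v. v \<in> carrier_vec d \<Longrightarrow> \<bar>qform A v\<bar> \<le> k * (v \<bullet> v)"
    using qform_bounded[OF A] by metis
  have "- k \<in> S" unfolding S_def using k(2) by (fastforce simp: abs_le_iff)
  then have ne: "S \<noteq> {}" by auto
  have upper: "c \<le> qform A v / (v \<bullet> v)" if "c \<in> S" "v \<in> carrier_vec d" "v \<noteq> 0\<^sub>v d" for c v
    using that scalar_prod_self_pos[of v d] by (auto simp: S_def field_simps)
  \<comment> \<open>A nonzero test vector, whose Rayleigh quotient bounds \<open>S\<close> above; it
    exists because \<open>d > 0\<close>.\<close>
  have u: "unit_vec d 0 \<in> carrier_vec d" "unit_vec d 0 \<noteq> (0\<^sub>v d :: real vec)"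
    using \<open>d > 0\<close> by (auto dest!: arg_cong[of _ _ "\<lambda>v. vec_index v 0"])
  have bdd: "bdd_above S" using upper[OF _ u] by (auto simp: bdd_above_def)
  \<comment> \<open>The supremum is attained: every Rayleigh quotient is an upper bound of
    \<open>S\<close>.\<close>
  have cS: "c * (v \<bullet> v) \<le> qform A v" if v: "v \<in> carrier_vec d" for v
  proof (cases "v = 0\<^sub>v d")
    case True
    then show ?thesis using A by (simp add: qform_def)
  next
    case False
    then have "c \<le> qform A v / (v \<bullet> v)" unfolding c_def using upper v ne by (intro cSup_least) auto
    then show ?thesis using scalar_prod_self_pos[OF v False] by (simp add: field_simps)
  qed
  define B where "B = char_matrix A c"
  have B: "B \<in> carrier_mat d d" using A by (simp add: B_def)
  have symB: "transpose_mat B = B"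
    using A sym by (simp add: B_def char_matrix_def transpose_add[of _ d d] transpose_smult)
  have qB: "qform B v = qform A v - c * (v \<bullet> v)" if "v \<in> carrier_vec d" for v
    using that A by (simp add: B_def char_matrix_def qform_add[of _ d] qform_smult[of _ d] qform_one)
  have psdB: "0 \<le> qform B v" if "v \<in> carrier_vec d" for v using qB cS that by simp
  have "eigenvalue A c"
  proof (rule ccontr)
    assume "\<not> eigenvalue A c"
    then have inj: "v = 0\<^sub>v d" if "v \<in> carrier_vec d" "B *\<^sub>v v = 0\<^sub>v d" for v
      using that eigenvalue_char_matrix[OF A] unfolding B_def by blast
    let ?D = "matinv B"
    have inv: "?D \<in> carrier_mat d d" "?D * B = 1\<^sub>m d"
      by (rule injective_mat_inverse[OF B inj]; assumption)+
    obtain k1 where k1: "k1 > 0" "\<And>v. v \<in> carrier_vec d \<Longrightarrow> \<bar>qform B v\<bar> \<le> k1 * (v \<bullet> v)"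
      using qform_bounded[OF B] by metis
    have "transpose_mat ?D * ?D \<in> carrier_mat d d" using inv(1) by simp
    from qform_bounded[OF this] obtain k2 where k2: "k2 > 0"
      "\<And>v. v \<in> carrier_vec d \<Longrightarrow> \<bar>qform (transpose_mat ?D * ?D) v\<bar> \<le> k2 * (v \<bullet> v)"
      by metis
    \<comment> \<open>Since \<open>v = ?D (B v)\<close>, the squared norm of \<open>v\<close> is at
      most \<open>k2\<close> times that of \<open>B v\<close>, which is at most
      \<open>k1 * qform B v\<close>. Hence \<open>B\<close> dominates \<open>1 / (k1 * k2)\<close>
      times the identity.\<close>
    have "c + 1 / (k1 * k2) \<in> S"
      unfolding S_def
    proof (intro CollectI ballI)
      fix v :: "real vec" assume v: "v \<in> carrier_vec d"
      let ?w = "B *\<^sub>v v"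
      have w: "?w \<in> carrier_vec d" using B v by simp
      have Dw: "?D *\<^sub>v ?w = v"
        using assoc_mult_mat_vec[OF inv(1) B v] inv(2) v by simp
      have Dt: "transpose_mat ?D \<in> carrier_mat d d" using inv(1) by simp
      have "(transpose_mat ?D * ?D) *\<^sub>v ?w = transpose_mat ?D *\<^sub>v v"
        by (rule trans[OF assoc_mult_mat_vec[OF Dt inv(1) w]]) (simp only: Dw)
      then have "qform (transpose_mat ?D * ?D) ?w = ?w \<bullet> (transpose_mat ?D *\<^sub>v v)"
        by (simp only: qform_def)
      also have "\<dots> = (transpose_mat ?D *\<^sub>v v) \<bullet> ?w"
        using Dt v by (intro comm_scalar_prod[OF w]) simp
      also have "\<dots> = v \<bullet> v"
        unfolding transpose_vec_mult_scalar[OF inv(1) w v] Dw ..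
      finally have "v \<bullet> v \<le> k2 * (?w \<bullet> ?w)" using k2(2)[OF w] by simp
      also have "?w \<bullet> ?w \<le> k1 * qform B v"
        using k1(2) by (intro scalar_prod_mult_mat_vec_le[OF B symB v psdB _ k1(1)])
          (auto simp: abs_le_iff)
      finally have "v \<bullet> v \<le> k2 * (k1 * qform B v)" using k2(1) by simp
      then have "(v \<bullet> v) / (k1 * k2) \<le> qform B v" using k1(1) k2(1) by (simp add: field_simps)
      then show "(c + 1 / (k1 * k2)) * (v \<bullet> v) \<le> qform A v"
        using qB[OF v] by (simp add: algebra_simps)
    qed
    then have "c + 1 / (k1 * k2) \<le> c" unfolding c_def using bdd by (rule cSup_upper)
    then show False using k1(1) k2(1) by (simp add: field_simps)
  qed
  with cS show thesis using that by blast
qed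


text \<open>The least eigenvalue of \<open>- A\<close> with its sign reversed; the eigenvector stays
  the same.\<close>

lemma symmetric_mat_greatest_eigenvalue:
  assumes A: "A \<in> carrier_mat d d" and sym: "transpose_mat A = A" and "d > 0"
  obtains c where "eigenvalue A c" "\<And>v. v \<in> carrier_vec d \<Longrightarrow> qform A v \<le> c * (v \<bullet> v)"
proof -
  have mA: "(-1) \<cdot>\<^sub>m A \<in> carrier_mat d d" using A by simp
  have "transpose_mat ((-1) \<cdot>\<^sub>m A) = (-1) \<cdot>\<^sub>m A" using sym by (simp add: transpose_smult)
  then obtain c where c: "eigenvalue ((-1) \<cdot>\<^sub>m A) c"
    "\<And>v. v \<in> carrier_vec d \<Longrightarrow> c * (v \<bullet> v) \<le> qform ((-1) \<cdot>\<^sub>m A) v"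
    using symmetric_mat_least_eigenvalue[OF mA _ \<open>d > 0\<close>] by metis
  from c(1) obtain v where v: "v \<in> carrier_vec d" "v \<noteq> 0\<^sub>v d" "((-1) \<cdot>\<^sub>m A) *\<^sub>v v = c \<cdot>\<^sub>v v"
    using A unfolding eigenvalue_def eigenvector_def by auto
  have "A *\<^sub>v v = (-1) \<cdot>\<^sub>v (((-1) \<cdot>\<^sub>m A) *\<^sub>v v)" using A v(1) by (auto intro!: eq_vecI)
  then have "A *\<^sub>v v = (- c) \<cdot>\<^sub>v v" by (simp add: v(3) smult_smult_assoc)
  then have "eigenvalue A (- c)" using A v unfolding eigenvalue_def eigenvector_def by auto
  moreover have "qform A v \<le> - c * (v \<bullet> v)" if "v \<in> carrier_vec d" for v
    using c(2)[OF that] qform_smult[OF A that, of "-1"] by simp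
  ultimately show thesis using that by blast
qed

text \<open>The two eigenvalues found above lie in the finite spectrum, so passing to
  \<open>Min\<close> and \<open>Max\<close> only weakens the bounds.\<close>

lemma qform_spectrum_bounds:
  assumes A: "A \<in> carrier_mat d d" and sym: "transpose_mat A = A" and "d > 0"
    and v: "v \<in> carrier_vec d"
  shows "Min (spectrum A) * (v \<bullet> v) \<le> qform A v" "qform A v \<le> Max (spectrum A) * (v \<bullet> v)"
proof -
  note fin = card_finite_spectrum(1)[OF A]
  obtain c where c: "eigenvalue A c" "\<And>v. v \<in> carrier_vec d \<Longrightarrow> c * (v \<bullet> v) \<le> qform A v"
    using symmetric_mat_least_eigenvalue[OF assms(1-3)] by metis
  have "Min (spectrum A) * (v \<bullet> v) \<le> c * (v \<bullet> v)"
    using c(1) fin by (intro mult_right_mono Min_le scalar_prod_self_nonneg) (auto simp: spectrum_def)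
  with c(2)[OF v] show "Min (spectrum A) * (v \<bullet> v) \<le> qform A v" by simp
  obtain c where c: "eigenvalue A c" "\<And>v. v \<in> carrier_vec d \<Longrightarrow> qform A v \<le> c * (v \<bullet> v)"
    using symmetric_mat_greatest_eigenvalue[OF assms(1-3)] by metis
  have "c * (v \<bullet> v) \<le> Max (spectrum A) * (v \<bullet> v)"
    using c(1) fin by (intro mult_right_mono Max_ge scalar_prod_self_nonneg) (auto simp: spectrum_def)
  with c(2)[OF v] show "qform A v \<le> Max (spectrum A) * (v \<bullet> v)" by simp
qed

lemma sym_pos_def_spectrum:
  assumes "sym_pos_def d A" "d > 0"
  shows "0 < Min (spectrum A)" "Min (spectrum A) \<le> Max (spectrum A)"
proof -
  have A: "A \<in> carrier_mat d d" "transpose_mat A = A"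
    and pos: "\<And>v. v \<in> carrier_vec d \<Longrightarrow> v \<noteq> 0\<^sub>v d \<Longrightarrow> 0 < qform A v"
    using assms(1) by (auto simp: sym_pos_def_def qform_def)
  note fin = card_finite_spectrum(1)[OF A(1)]
  \<comment> \<open>A real eigenvalue exists, so the spectrum is nonempty and its \<open>Min\<close>
    is a genuine eigenvalue. Testing the form on an eigenvector for it gives positivity.\<close>
  obtain c where "eigenvalue A c" using symmetric_mat_least_eigenvalue[OF A assms(2)] by metis
  then have ne: "spectrum A \<noteq> {}" by (auto simp: spectrum_def)
  from Min_in[OF fin ne] obtain v where v: "v \<in> carrier_vec d" "v \<noteq> 0\<^sub>v d"
    "A *\<^sub>v v = Min (spectrum A) \<cdot>\<^sub>v v"
    using A(1) unfolding spectrum_def eigenvalue_def eigenvector_def by auto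
  have "qform A v = Min (spectrum A) * (v \<bullet> v)" using v by (simp add: qform_def)
  then show "0 < Min (spectrum A)" using pos[OF v(1,2)] scalar_prod_self_pos[OF v(1,2)]
    by (metis zero_less_mult_pos2)
  show "Min (spectrum A) \<le> Max (spectrum A)" using Min_le[OF fin] Max_in[OF fin ne] by blast
qed

section \<open>Positive definite matrices and the shifted product \<open>P * Q * P\<close>\<close>

text \<open>A form bounded below by a positive multiple of the identity has no nonzero kernel
  vector. This serves for both \<open>\<Gamma>\<close> and \<open>R\<close>.\<close>

lemma positive_mat_inverse:
  assumes A: "A \<in> carrier_mat d d"
    and bound: "\<And>v. v \<in> carrier_vec d \<Longrightarrow> \<alpha> * (v \<bullet> v) \<le> qform A v" and "\<alpha> > 0"
  shows "matinv A \<in> carrier_mat d d" "A * matinv A = 1\<^sub>m d" "matinv A * A = 1\<^sub>m d"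
proof -
  have inj: "v = 0\<^sub>v d" if v: "v \<in> carrier_vec d" and Av: "A *\<^sub>v v = 0\<^sub>v d" for v
  proof (rule ccontr)
    assume "v \<noteq> 0\<^sub>v d"
    then have "0 < \<alpha> * (v \<bullet> v)" using scalar_prod_self_pos[OF v] \<open>\<alpha> > 0\<close> by simp
    then show False using bound[OF v] v Av by (simp add: qform_def)
  qed
  show "matinv A \<in> carrier_mat d d" "A * matinv A = 1\<^sub>m d" "matinv A * A = 1\<^sub>m d"
    by (rule injective_mat_inverse[OF A inj]; assumption)+
qed

text \<open>\<open>R\<^sup>-\<^sup>1 - 2 t I + t\<^sup>2 R\<close> is positive semidefinite, being \<open>(I - t R) R\<^sup>-\<^sup>1 (I - t R)\<close>.\<close>

lemma qform_inverse_tangent: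
  assumes R: "R \<in> carrier_mat d d" and sym: "transpose_mat R = R" and Q: "Q \<in> carrier_mat d d"
    and RQ: "R * Q = 1\<^sub>m d"
    and psd: "\<And>v. v \<in> carrier_vec d \<Longrightarrow> 0 \<le> qform R v" and v: "v \<in> carrier_vec d"
  shows "0 \<le> qform Q v - 2 * t * (v \<bullet> v) + t\<^sup>2 * qform R v"
proof -
  have w: "Q *\<^sub>v v \<in> carrier_vec d" using Q v by simp
  note inv = qform_inverse[OF R Q RQ v]
  have "0 \<le> qform R (Q *\<^sub>v v - t \<cdot>\<^sub>v v)" using psd v w by simp
  also have "\<dots> = qform Q v - 2 * t * (v \<bullet> v) + t\<^sup>2 * qform R v"
    using qform_minus_smult_vec[OF R sym v w, of t] inv by simp
  finally show ?thesis .
qed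

text \<open>Symmetry of \<open>P\<close> reduces the form to that of \<open>Q\<close> at
  \<open>P v = R v - a v\<close>, which is expanded using \<open>Q (R v) = v\<close>.\<close>

lemma qform_conj_shifted:
  assumes R: "R \<in> carrier_mat d d" and sym: "transpose_mat R = R" and Q: "Q \<in> carrier_mat d d"
    and RQ: "R * Q = 1\<^sub>m d" and QR: "Q * R = 1\<^sub>m d"
    and P: "P \<in> carrier_mat d d" and P_eq: "P = R - a \<cdot>\<^sub>m 1\<^sub>m d" and v: "v \<in> carrier_vec d"
  shows "qform (P * Q * P) v = qform R v - 2 * a * (v \<bullet> v) + a\<^sup>2 * qform Q v"
proof -
  have symQ: "transpose_mat Q = Q" by (rule transpose_inverse_symmetric[OF R sym Q RQ QR])
  have symP: "transpose_mat P = P"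
    unfolding P_eq using R sym by (simp add: transpose_minus[of _ d d] transpose_smult)
  have Pv: "P *\<^sub>v v = R *\<^sub>v v - a \<cdot>\<^sub>v v"
  proof -
    have "(a \<cdot>\<^sub>m 1\<^sub>m d) *\<^sub>v v = a \<cdot>\<^sub>v v" using v by (auto intro!: eq_vecI)
    then show ?thesis unfolding P_eq using R v by (simp add: minus_mult_distrib_mat_vec[of _ d d])
  qed
  have Pvc: "P *\<^sub>v v \<in> carrier_vec d" and Rv: "R *\<^sub>v v \<in> carrier_vec d" using P R v by simp_all
  have QRv: "Q *\<^sub>v (R *\<^sub>v v) = v" using assoc_mult_mat_vec[OF Q R v] QR v by simp
  have "(P * Q * P) *\<^sub>v v = P *\<^sub>v (Q *\<^sub>v (P *\<^sub>v v))"
    using P Q v by (simp add: assoc_mult_mat_vec[of _ d d _ d])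
  then have "qform (P * Q * P) v = qform Q (P *\<^sub>v v)"
    using symmetric_mat_scalar_prod[OF P symP v, of "Q *\<^sub>v (P *\<^sub>v v)"] Q Pvc by (simp add: qform_def)
  also have "\<dots> = qform R v - 2 * a * (v \<bullet> v) + a\<^sup>2 * qform Q v"
    unfolding Pv using qform_minus_smult_vec[OF Q symQ v Rv, of a] QRv comm_scalar_prod[OF Rv v]
    by (simp add: qform_def)
  finally show ?thesis .
qed

section \<open>Square integrability and integrated forms\<close>

text \<open>Asking for all products of entries makes every quadratic form in \<open>f s\<close>
  integrable as a finite linear combination.\<close>

definition square_integrable :: "nat \<Rightarrow> real set \<Rightarrow> (real \<Rightarrow> real vec) \<Rightarrow> bool" where
  "square_integrable d S f \<longleftrightarrow> (\<forall>s \<in> S. f s \<in> carrier_vec d) \<and>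
     (\<forall>i < d. \<forall>j < d. set_integrable lborel S (\<lambda>s. f s $ i * f s $ j))"

text \<open>Measurability of the slice at \<open>T\<close> comes from composing with
  \<open>s\<close> to \<open>(T, s)\<close>; its squared norm has finite integral because
  \<open>t = T\<close> is among the times of the finite supremum.\<close>

lemma volterra_kernel_square_integrable:
  assumes K: "volterra_kernel d T K" and "T > 0"
  shows "square_integrable d {0..T} (K T)"
proof -
  let ?S = "{0..T}"
  have carr: "K T s \<in> carrier_vec d" if "s \<in> ?S" for s
    using K that \<open>T > 0\<close> by (auto simp: volterra_kernel_def)
  have meas: "(\<lambda>s. indicator ?S s *\<^sub>R (K T s $ i)) \<in> borel_measurable borel" if i: "i < d" for i
  proof -
    have "(\<lambda>(t, s). K t s $ i) \<in> borel_measurable (restrict_space borel (?S \<times> ?S))"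
      using K i by (simp add: volterra_kernel_def)
    moreover have "(\<lambda>s. (T, s)) \<in> restrict_space borel ?S \<rightarrow>\<^sub>M restrict_space borel (?S \<times> ?S)"
      using \<open>T > 0\<close> by (intro measurable_restrict_space3 borel_measurable_continuous_onI continuous_intros) auto
    ultimately have "(\<lambda>s. case (T, s) of (t, s) \<Rightarrow> K t s $ i) \<in> borel_measurable (restrict_space borel ?S)"
      by (rule measurable_compose[rotated])
    then have "(\<lambda>s. K T s $ i) \<in> borel_measurable (restrict_space borel ?S)" by simp
    then show ?thesis by (subst (asm) borel_measurable_restrict_space_iff) auto
  qed
  have meas2: "(\<lambda>s. indicator ?S s *\<^sub>R (K T s $ i * K T s $ j)) \<in> borel_measurable borel"
    if "i < d" "j < d" for i j
  proof -
    have "(\<lambda>s. (indicator ?S s *\<^sub>R (K T s $ i)) * (indicator ?S s *\<^sub>R (K T s $ j))) \<in> borel_measurable borel"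
      using meas that by (intro borel_measurable_times) auto
    also have "(\<lambda>s. (indicator ?S s *\<^sub>R (K T s $ i)) * (indicator ?S s *\<^sub>R (K T s $ j)))
        = (\<lambda>s. indicator ?S s *\<^sub>R (K T s $ i * K T s $ j))"
      by (auto simp: indicator_def)
    finally show ?thesis .
  qed
  have "(\<integral>\<^sup>+ s \<in> ?S. ennreal ((euclid_norm (K T s))\<^sup>2) \<partial>lborel)
      \<le> (SUP t \<in> ?S. \<integral>\<^sup>+ s \<in> ?S. ennreal ((euclid_norm (K t s))\<^sup>2) \<partial>lborel)"
    using \<open>T > 0\<close> by (intro SUP_upper) auto
  also have "\<dots> < \<infinity>" using K by (simp add: volterra_kernel_def)
  finally have fin: "(\<integral>\<^sup>+ s \<in> ?S. ennreal ((euclid_norm (K T s))\<^sup>2) \<partial>lborel) < \<infinity>" .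
  have "set_integrable lborel ?S (\<lambda>s. K T s $ i * K T s $ j)" if ij: "i < d" "j < d" for i j
    unfolding set_integrable_def
  proof (rule integrableI_bounded)
    show "(\<lambda>s. indicator ?S s *\<^sub>R (K T s $ i * K T s $ j)) \<in> borel_measurable lborel"
      using meas2[OF ij] by simp
    have "(\<integral>\<^sup>+ s. ennreal (norm (indicator ?S s *\<^sub>R (K T s $ i * K T s $ j))) \<partial>lborel)
        \<le> (\<integral>\<^sup>+ s \<in> ?S. ennreal ((euclid_norm (K T s))\<^sup>2) \<partial>lborel)"
      using abs_mult_index_le_scalar_prod_self[OF carr ij]
      by (intro nn_integral_mono) (auto simp: euclid_norm_def scalar_prod_self_nonneg indicator_def
          intro!: ennreal_leI)
    with fin show "(\<integral>\<^sup>+ s. ennreal (norm (indicator ?S s *\<^sub>R (K T s $ i * K T s $ j))) \<partial>lborel) < \<infinity>"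
      by (rule le_less_trans[rotated])
  qed
  then show ?thesis using carr by (auto simp: square_integrable_def)
qed

lemma qform_set_integrable:
  assumes f: "square_integrable d S f" and A: "A \<in> carrier_mat d d"
  shows "set_integrable lborel S (\<lambda>s. qform A (f s))"
proof -
  have "set_integrable lborel S (\<lambda>s. \<Sum>i<d. \<Sum>j<d. A $$ (i, j) * (f s $ i * f s $ j))"
    unfolding set_integrable_def scaleR_sum_right
  proof (intro Bochner_Integration.integrable_sum)
    fix i j assume "i \<in> {..<d}" "j \<in> {..<d}"
    then have "set_integrable lborel S (\<lambda>s. A $$ (i, j) * (f s $ i * f s $ j))"
      using f by (intro set_integrable_mult_right) (auto simp: square_integrable_def)
    then show "integrable lborel (\<lambda>s. indicator S s *\<^sub>R (A $$ (i, j) * (f s $ i * f s $ j)))"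
      by (simp only: set_integrable_def)
  qed
  then show ?thesis
    using f A by (subst set_integrable_cong[OF refl]) (auto simp: qform_eq_sum square_integrable_def)
qed

context
  fixes d :: nat and T :: real and f :: "real \<Rightarrow> real vec"
  assumes f: "square_integrable d {0..T} f"
begin

lemma square_integrable_carrier: "s \<in> {0..T} \<Longrightarrow> f s \<in> carrier_vec d"
  using f by (auto simp: square_integrable_def)

lemma L2_form_eq: "L2_form T A f = (LBINT s:{0..T}. qform A (f s))"
  by (simp add: L2_form_def L2_inner_def qform_def)

text \<open>Three terms cover every combination used later; shorter ones are padded with coefficient
  \<open>0\<close>.\<close>

lemma integral_qform_lincomb:
  assumes "A \<in> carrier_mat d d" "B \<in> carrier_mat d d" "C \<in> carrier_mat d d"
  shows "(LBINT s:{0..T}. a * qform A (f s) + b * qform B (f s) + c * qform C (f s))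
    = a * L2_form T A f + b * L2_form T B f + c * L2_form T C f"
  unfolding L2_form_eq using assms by (simp add: qform_set_integrable[OF f])

lemma L2_form_lincomb:
  assumes "A \<in> carrier_mat d d" "B \<in> carrier_mat d d" "C \<in> carrier_mat d d"
    and "\<And>v. v \<in> carrier_vec d \<Longrightarrow> qform D v = a * qform A v + b * qform B v + c * qform C v"
  shows "L2_form T D f = a * L2_form T A f + b * L2_form T B f + c * L2_form T C f"
  unfolding integral_qform_lincomb[OF assms(1-3), symmetric] L2_form_eq[of D]
  using assms(4) square_integrable_carrier by (intro set_lebesgue_integral_cong) auto

text \<open>This carries pointwise matrix inequalities over to the integrated forms. For
  \<open>Q - 2 t I + t^2 R\<close> it yields Cauchy-Schwarz after integration.\<close>

lemma L2_form_lincomb_nonneg: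
  assumes "A \<in> carrier_mat d d" "B \<in> carrier_mat d d" "C \<in> carrier_mat d d"
    and "\<And>v. v \<in> carrier_vec d \<Longrightarrow> 0 \<le> a * qform A v + b * qform B v + c * qform C v"
  shows "0 \<le> a * L2_form T A f + b * L2_form T B f + c * L2_form T C f"
  unfolding integral_qform_lincomb[OF assms(1-3), symmetric] set_lebesgue_integral_def
  using assms(4) square_integrable_carrier by (intro Bochner_Integration.integral_nonneg) (auto simp: indicator_def)

end

section \<open>Scalar estimates\<close>

lemma gap_bounds:
  fixes a n X Y \<rho> \<beta> :: real
  assumes "0 \<le> n" "0 < \<rho>" "\<rho> * n \<le> X" "X \<le> \<beta> * n" "Y \<le> n / \<rho>"
    and tangent: "\<And>t. 0 \<le> Y - 2 * t * n + t\<^sup>2 * X"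
  defines "\<Delta> \<equiv> X - 2 * a * n + a\<^sup>2 * Y - (X - a * n) / X * (X - a * n)"
  shows "0 \<le> \<Delta>" "\<Delta> \<le> a\<^sup>2 * n * (1 / \<rho> - 1 / \<beta>)"
proof -
  have "0 \<le> \<Delta> \<and> \<Delta> \<le> a\<^sup>2 * n * (1 / \<rho> - 1 / \<beta>)"
  proof (cases "n = 0")
    case True
    \<comment> \<open>The degenerate kernel, where the quotient in \<open>\<Delta>\<close> is
      \<open>0 / 0 = 0\<close>. \<open>Y\<close> is squeezed between the tangent inequality at
      \<open>0\<close> and \<open>n / \<rho> = 0\<close>.\<close>
    then have "X = 0" "Y = 0" using assms(3-5) tangent[of 0] by auto
    then show ?thesis using True by (simp add: \<Delta>_def)
  next
    case False
    then have n: "n > 0" using assms(1) by simp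
    have X: "X > 0" using assms(2,3) n mult_pos_pos[of \<rho> n] by linarith
    have "0 < \<beta> * n" using X assms(4) by linarith
    then have \<beta>: "\<beta> > 0" using n by (simp add: zero_less_mult_iff)
    have \<Delta>: "\<Delta> = a\<^sup>2 * (Y - n\<^sup>2 / X)"
      unfolding \<Delta>_def using X by (simp add: field_simps power2_eq_square)
    \<comment> \<open>The value \<open>t = n / X\<close> minimises the quadratic in
      \<open>t\<close>.\<close>
    have "0 \<le> Y - n\<^sup>2 / X" using tangent[of "n / X"] X by (simp add: field_simps power2_eq_square)
    moreover have "n / \<beta> \<le> n\<^sup>2 / X"
      using mult_left_mono[OF assms(4), of n] n X \<beta> by (simp add: field_simps power2_eq_square)
    then have "Y - n\<^sup>2 / X \<le> n * (1 / \<rho> - 1 / \<beta>)" using assms(5) by (simp add: algebra_simps)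
    then have "\<Delta> \<le> a\<^sup>2 * (n * (1 / \<rho> - 1 / \<beta>))" unfolding \<Delta> by (intro mult_left_mono) auto
    ultimately show ?thesis by (simp add: \<Delta> mult.assoc)
  qed
  then show "0 \<le> \<Delta>" "\<Delta> \<le> a\<^sup>2 * n * (1 / \<rho> - 1 / \<beta>)" by auto
qed

text \<open>The numerator \<open>1 / l - 1 / u\<close> equals \<open>(u / l - 1) / u\<close>. Here
  \<open>1 / u\<close> is absorbed by the factor \<open>\<gamma> + 1 / u\<close> and the other
  factor is at least \<open>\<gamma>\<close>, so only the ratio \<open>u / l\<close> remains and the
  scale of the eigenvalues drops out.\<close>

lemma inverse_shifted_gap_le:
  fixes \<gamma> l u :: real
  assumes "0 < \<gamma>" "0 < l" "l \<le> u"
  shows "1 / (\<gamma> + 1 / u) - 1 / (\<gamma> + 1 / l) \<le> (u / l - 1) / \<gamma>"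
proof -
  have u: "0 < u" using assms by simp
  have pos: "0 < \<gamma> + 1 / u" "0 < \<gamma> + 1 / l" using assms u by (auto intro!: add_pos_pos)
  have "1 / (\<gamma> + 1 / u) - 1 / (\<gamma> + 1 / l) = (1 / l - 1 / u) / ((\<gamma> + 1 / u) * (\<gamma> + 1 / l))"
    using pos by (subst diff_frac_eq) auto
  also have "\<dots> = ((u / l - 1) * (1 / u)) / ((\<gamma> + 1 / u) * (\<gamma> + 1 / l))"
    using u assms by (simp add: field_simps)
  also have "\<dots> \<le> ((u / l - 1) * (\<gamma> + 1 / u)) / ((\<gamma> + 1 / u) * (\<gamma> + 1 / l))"
    using pos assms u by (intro divide_right_mono mult_left_mono) auto
  also have "\<dots> = (u / l - 1) / (\<gamma> + 1 / l)" using pos by simp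
  also have "\<dots> \<le> (u / l - 1) / \<gamma>" using assms u pos by (intro divide_left_mono) auto
  finally show ?thesis .
qed

section \<open>The bounds on the utility gap\<close>

text \<open>In the constant, \<open>\<gamma>\<^sub>A\<^sup>2\<close> comes from the shift between
  \<open>P\<close> and \<open>R\<close>, and
  \<open>1 / (\<gamma>\<^sub>A + \<gamma>\<^sub>P)\<close> from the estimate of the inverse
  eigenvalues of \<open>R\<close>.\<close>

lemma chi0_minus_phi0_bounds:
  assumes "\<gamma>\<^sub>A > 0" and "\<gamma>\<^sub>P > 0" and "d > 0" and \<Gamma>: "sym_pos_def d \<Gamma>"
    and "T > 0" and K: "volterra_kernel d T K"
  defines "n \<equiv> LBINT t:{0..T}. (euclid_norm (K T t))\<^sup>2"
  shows "0 \<le> chi0 d \<gamma>\<^sub>A \<gamma>\<^sub>P \<Gamma> T K - phi0 d \<gamma>\<^sub>A \<gamma>\<^sub>P \<Gamma> T K"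
    and "chi0 d \<gamma>\<^sub>A \<gamma>\<^sub>P \<Gamma> T K - phi0 d \<gamma>\<^sub>A \<gamma>\<^sub>P \<Gamma> T K
      \<le> \<gamma>\<^sub>P / 2 * (\<gamma>\<^sub>A\<^sup>2 / (\<gamma>\<^sub>A + \<gamma>\<^sub>P)) * (Cond \<Gamma> - 1) * n"
proof -
  let ?I = "1\<^sub>m d :: real mat"
  define \<gamma> where "\<gamma> = \<gamma>\<^sub>A + \<gamma>\<^sub>P"
  have \<gamma>: "\<gamma> > 0" using assms by (simp add: \<gamma>_def)
  define l u where "l = Min (spectrum \<Gamma>)" and "u = Max (spectrum \<Gamma>)"
  have G: "\<Gamma> \<in> carrier_mat d d" "transpose_mat \<Gamma> = \<Gamma>" using \<Gamma> by (auto simp: sym_pos_def_def)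
  have l: "0 < l" "l \<le> u" using sym_pos_def_spectrum[OF \<Gamma> \<open>d > 0\<close>] by (simp_all add: l_def u_def)
  then have u: "0 < u" by simp
  note G_bounds = qform_spectrum_bounds[OF G \<open>d > 0\<close>, folded l_def u_def]
  have G_psd: "0 \<le> qform \<Gamma> v" if "v \<in> carrier_vec d" for v
    using G_bounds(1)[OF that] l(1) scalar_prod_self_nonneg[of v]
    by (meson mult_nonneg_nonneg less_imp_le order_trans)

  define M where "M = matinv \<Gamma>"
  note M = positive_mat_inverse[OF G(1) G_bounds(1) l(1), folded M_def]
  have symM: "transpose_mat M = M" by (rule transpose_inverse_symmetric[OF G M])
  \<comment> \<open>Inversion exchanges the extreme eigenvalues: \<open>u\<close> gives the lower
    bound and \<open>l\<close> the upper one.\<close>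
  have M_ge: "(v \<bullet> v) / u \<le> qform M v" if "v \<in> carrier_vec d" for v
    by (rule qform_inverse_ge[OF G M(1,2) that G_psd G_bounds(2) u])
  have M_le: "qform M v \<le> (v \<bullet> v) / l" if "v \<in> carrier_vec d" for v
    by (rule qform_inverse_le[OF G(1) M(1,2) that G_bounds(1) l(1)])

  define R where "R = shifted_inv d \<gamma> \<Gamma>"
  define P where "P = shifted_inv d \<gamma>\<^sub>P \<Gamma>"
  define Q where "Q = matinv R"
  have R: "R \<in> carrier_mat d d" and P: "P \<in> carrier_mat d d"
    using M(1) by (simp_all add: R_def P_def shifted_inv_def M_def)
  have symR: "transpose_mat R = R"
    unfolding R_def shifted_inv_def M_def[symmetric]
    using M(1) symM by (simp add: transpose_add[of _ d d] transpose_smult)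
  have P_eq: "P = R - \<gamma>\<^sub>A \<cdot>\<^sub>m ?I"
    unfolding P_def R_def shifted_inv_def M_def[symmetric] \<gamma>_def
    by (rule eq_matI) (use M(1) in \<open>auto simp: algebra_simps\<close>)
  have qR: "qform R v = \<gamma> * (v \<bullet> v) + qform M v" if "v \<in> carrier_vec d" for v
    using that M(1) unfolding R_def shifted_inv_def M_def[symmetric]
    by (simp add: qform_add[of _ d] qform_smult[of _ d] qform_one)
  have qP: "qform P v = qform R v - \<gamma>\<^sub>A * (v \<bullet> v)" if "v \<in> carrier_vec d" for v
    using that R unfolding P_eq by (simp add: qform_minus[of _ d] qform_smult[of _ d] qform_one)
  define \<rho> \<beta> where "\<rho> = \<gamma> + 1 / u" and "\<beta> = \<gamma> + 1 / l"
  have \<rho>: "\<rho> > 0" using \<gamma> u by (simp add: \<rho>_def add_pos_pos)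
  have R_ge: "\<rho> * (v \<bullet> v) \<le> qform R v" if "v \<in> carrier_vec d" for v
    using M_ge[OF that] qR[OF that] by (simp add: \<rho>_def algebra_simps)
  have R_le: "qform R v \<le> \<beta> * (v \<bullet> v)" if "v \<in> carrier_vec d" for v
    using M_le[OF that] qR[OF that] by (simp add: \<beta>_def algebra_simps)
  have R_psd: "0 \<le> qform R v" if "v \<in> carrier_vec d" for v
    using R_ge[OF that] \<rho> scalar_prod_self_nonneg[of v]
    by (meson mult_nonneg_nonneg less_imp_le order_trans)
  note Q = positive_mat_inverse[OF R R_ge \<rho>, folded Q_def]
  have Q_le: "qform Q v \<le> (v \<bullet> v) / \<rho>" if "v \<in> carrier_vec d" for v
    by (rule qform_inverse_le[OF R Q(1,2) that R_ge \<rho>])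
  have I: "?I \<in> carrier_mat d d" by simp
  have PQP: "P * Q * P \<in> carrier_mat d d" using P Q(1) by simp

  note K2 = volterra_kernel_square_integrable[OF K \<open>T > 0\<close>]
  note lincomb = L2_form_lincomb[OF K2] and nonneg = L2_form_lincomb_nonneg[OF K2]
  let ?F = "\<lambda>A. L2_form T A (K T)"
  define X Y where "X = ?F R" and "Y = ?F Q"
  have n: "n = ?F ?I"
    unfolding n_def L2_form_eq[OF K2]
    using square_integrable_carrier[OF K2]
    by (intro set_lebesgue_integral_cong) (auto simp: qform_one euclid_norm_def scalar_prod_self_nonneg)
  have n0: "0 \<le> n"
    using nonneg[OF I I I, of 1 0 0] by (simp add: n qform_one scalar_prod_self_nonneg)
  have X_ge: "\<rho> * n \<le> X"
    using nonneg[OF R I I, of 1 "- \<rho>" 0] R_ge by (simp add: n X_def qform_one)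
  have X_le: "X \<le> \<beta> * n"
    using nonneg[OF R I I, of "-1" \<beta> 0] R_le by (simp add: n X_def qform_one)
  have Y_le: "Y \<le> n / \<rho>"
    using nonneg[OF Q(1) I I, of "-1" "1 / \<rho>" 0] Q_le by (simp add: n Y_def qform_one)
  have tangent: "0 \<le> Y - 2 * t * n + t\<^sup>2 * X" for t
    using nonneg[OF Q(1) I R, of 1 "- (2 * t)" "t\<^sup>2"]
      qform_inverse_tangent[OF R symR Q(1,2) R_psd, of _ t]
    by (simp add: n X_def Y_def qform_one)
  have FP: "?F P = X - \<gamma>\<^sub>A * n"
    using lincomb[OF R I I, of P 1 "- \<gamma>\<^sub>A" 0] qP by (simp add: n X_def qform_one)
  have FPQP: "?F (P * Q * P) = X - 2 * \<gamma>\<^sub>A * n + \<gamma>\<^sub>A\<^sup>2 * Y"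
    using lincomb[OF R I Q(1), of "P * Q * P" 1 "- (2 * \<gamma>\<^sub>A)" "\<gamma>\<^sub>A\<^sup>2"]
      qform_conj_shifted[OF R symR Q P P_eq]
    by (simp add: n X_def Y_def qform_one)
  have phi: "phi0 d \<gamma>\<^sub>A \<gamma>\<^sub>P \<Gamma> T K = \<gamma>\<^sub>P / 2 * (\<gamma>\<^sub>P * n - ?F (P * Q * P))"
    using lincomb[OF I PQP I, of "\<gamma>\<^sub>P \<cdot>\<^sub>m ?I - P * Q * P" "\<gamma>\<^sub>P" "-1" 0] PQP
    unfolding phi0_def P_def[symmetric] \<gamma>_def[symmetric] R_def[symmetric] Q_def[symmetric]
    by (simp add: n qform_minus[of _ d] qform_smult[of _ d])
  define b where "b = b_star d \<gamma>\<^sub>A \<gamma>\<^sub>P \<Gamma> T K"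
  \<comment> \<open>This holds for \<open>X = 0\<close> as well, so the degenerate kernel is treated
    only in the scalar estimate.\<close>
  have b: "b = (X - \<gamma>\<^sub>A * n) / X"
    unfolding b_def b_star_def P_def[symmetric] \<gamma>_def[symmetric] R_def[symmetric] FP X_def ..
  have chi: "chi0 d \<gamma>\<^sub>A \<gamma>\<^sub>P \<Gamma> T K = \<gamma>\<^sub>P / 2 * (\<gamma>\<^sub>P * n - b * ?F P)"
    using lincomb[OF I P I, of "\<gamma>\<^sub>P \<cdot>\<^sub>m ?I - b \<cdot>\<^sub>m P" "\<gamma>\<^sub>P" "- b" 0] P
    unfolding chi0_def P_def[symmetric] b_def[symmetric]
    by (simp add: n qform_minus[of _ d] qform_smult[of _ d])
  define \<Delta> where "\<Delta> = X - 2 * \<gamma>\<^sub>A * n + \<gamma>\<^sub>A\<^sup>2 * Y - (X - \<gamma>\<^sub>A * n) / X * (X - \<gamma>\<^sub>A * n)"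
  \<comment> \<open>The terms \<open>\<gamma>\<^sub>P * n\<close> cancel, leaving the form of
    \<open>P * Q * P\<close> minus \<open>b\<close> times that of \<open>P\<close>.\<close>
  have gap: "chi0 d \<gamma>\<^sub>A \<gamma>\<^sub>P \<Gamma> T K - phi0 d \<gamma>\<^sub>A \<gamma>\<^sub>P \<Gamma> T K = \<gamma>\<^sub>P / 2 * \<Delta>"
    unfolding phi chi FP FPQP b \<Delta>_def by (simp only: right_diff_distrib[symmetric]) simp
  note \<Delta> = gap_bounds[OF n0 \<rho> X_ge X_le Y_le tangent, of \<gamma>\<^sub>A, folded \<Delta>_def]
  show "0 \<le> chi0 d \<gamma>\<^sub>A \<gamma>\<^sub>P \<Gamma> T K - phi0 d \<gamma>\<^sub>A \<gamma>\<^sub>P \<Gamma> T K"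
    unfolding gap using \<Delta>(1) \<open>\<gamma>\<^sub>P > 0\<close> by simp
  have "\<Delta> \<le> \<gamma>\<^sub>A\<^sup>2 * n * ((u / l - 1) / \<gamma>)"
    using \<Delta>(2) inverse_shifted_gap_le[OF \<gamma> l] n0 unfolding \<rho>_def \<beta>_def
    by (meson mult_left_mono mult_nonneg_nonneg order_trans zero_le_power2)
  then have "\<gamma>\<^sub>P / 2 * \<Delta> \<le> \<gamma>\<^sub>P / 2 * (\<gamma>\<^sub>A\<^sup>2 * n * ((u / l - 1) / \<gamma>))"
    using \<open>\<gamma>\<^sub>P > 0\<close> by (intro mult_left_mono) auto
  also have "\<dots> = \<gamma>\<^sub>P / 2 * (\<gamma>\<^sub>A\<^sup>2 / (\<gamma>\<^sub>A + \<gamma>\<^sub>P)) * (Cond \<Gamma> - 1) * n"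
    by (simp add: Cond_def l_def u_def \<gamma>_def)
  finally show "chi0 d \<gamma>\<^sub>A \<gamma>\<^sub>P \<Gamma> T K - phi0 d \<gamma>\<^sub>A \<gamma>\<^sub>P \<Gamma> T K
      \<le> \<gamma>\<^sub>P / 2 * (\<gamma>\<^sub>A\<^sup>2 / (\<gamma>\<^sub>A + \<gamma>\<^sub>P)) * (Cond \<Gamma> - 1) * n"
    unfolding gap .
qed

theorem proposition5p3:
  fixes \<gamma>\<^sub>A \<gamma>\<^sub>P :: real
  assumes "\<gamma>\<^sub>A > 0" and "\<gamma>\<^sub>P > 0"
  shows "\<exists>C > 0. \<forall>(d :: nat) (\<Gamma> :: real mat) (T :: real) (K :: real \<Rightarrow> real \<Rightarrow> real vec).
    d \<ge> 1 \<longrightarrow> sym_pos_def d \<Gamma> \<longrightarrow> T > 0 \<longrightarrow> volterra_kernel d T K \<longrightarrow>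
      0 \<le> chi0 d \<gamma>\<^sub>A \<gamma>\<^sub>P \<Gamma> T K - phi0 d \<gamma>\<^sub>A \<gamma>\<^sub>P \<Gamma> T K \<and>
      chi0 d \<gamma>\<^sub>A \<gamma>\<^sub>P \<Gamma> T K - phi0 d \<gamma>\<^sub>A \<gamma>\<^sub>P \<Gamma> T K
        \<le> C * (Cond \<Gamma> - 1) * (LBINT t:{0..T}. (euclid_norm (K T t))\<^sup>2)"
proof (intro exI conjI allI impI)
  \<comment> \<open>The constant involves only the two risk aversions, hence is uniform in all
    quantified data.\<close>
  show "\<gamma>\<^sub>P / 2 * (\<gamma>\<^sub>A\<^sup>2 / (\<gamma>\<^sub>A + \<gamma>\<^sub>P)) > 0" using assms by simp
qed (use chi0_minus_phi0_bounds[OF assms] in auto)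

end
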